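(* Let $n=2m\ge 4$ be even and let $U=U(\alpha,\beta,\gamma,\delta)$ be the $2^n\times 2^n$ Markov matrix of the boundary driven rule-54 cellular automaton defined in the context. If $0<\alpha,\beta,\gamma,\delta<1$, then $U$ is irreducible and aperiodic.
   Context: Model. Let $\mathbb{Z}_2=\{0,1\}$ and $\chi(w,c,e)= c+w+e+we \pmod 2$ for $w,c,e\in\mathbb{Z}_2$ (the middle argument is the cell being updated, the outer two are its neighbours). Vectors $p\in\mathbb{R}^{2^n}=(\mathbb{R}^2)^{\otimes n}$ have components $p_{s_1,\dots,s_n}$ indexed by configurations $\underline{s}=(s_1,\dots,s_n)\in\mathbb{Z}_2^n$; matrices act on column vectors (first index = row = final configuration, second index = column = initial configuration). Bulk: $P$ is the $8\times 8$ permutation matrix $P_{(s,s',s''),(t,t',t'')}=\delta_{s,t}\,\delta_{s',\chi(t,t',t'')}\,\delta_{s'',t''}$. Boundaries: for $\alpha,\beta\in[0,1]$ let $E^{\alpha,\beta}=\begin{pmatrix}1-\alpha&\beta\\ \alpha&1-\beta\end{pmatrix}$ and define the $4\times4$ matrices $\tilde P^{\rm L}_{(s',s''),(t',t'')}=\frac12\sum_{s=0}^1 P_{(s,s',s''),(s,t',t'')}$, $\tilde P^{\rm R}_{(s,s'),(t,t')}=\frac12\sum_{s''=0}^1 P_{(s,s',s''),(t,t',s'')}$, $P^{\rm L}=\tilde P^{\rm L}(E^{\alpha,\beta}\otimes \mathbb{1}_2)$, $P^{\rm R}=\tilde P^{\rm R}(\mathbb{1}_2\otimes E^{\gamma,\delta})$.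 Propagator: with $P_{k,k+1,k+2}=\mathbb{1}_{2^{k-1}}\otimes P\otimes \mathbb{1}_{2^{n-k-2}}$, $P^{\rm L}_{12}=P^{\rm L}\otimes \mathbb{1}_{2^{n-2}}$, $P^{\rm R}_{n-1,n}=\mathbb{1}_{2^{n-2}}\otimes P^{\rm R}$, put $U_{\rm e}=P_{123}P_{345}\cdots P_{n-3,n-2,n-1}P^{\rm R}_{n-1,n}$, $U_{\rm o}=P_{n-2,n-1,n}\cdots P_{456}P_{234}P^{\rm L}_{12}$, $U=U_{\rm o}U_{\rm e}$. A finite nonnegative matrix $U$ is irreducible if for every pair of configurations $\underline s,\underline s'$ there is $t_0\in\mathbb{N}$ with $(U^{t_0})_{\underline s',\underline s}>0$. An irreducible $U$ is aperiodic if for some configuration $\underline s$ the greatest common divisor of all $t\in\mathbb{N}$ with $(U^t)_{\underline s,\underline s}>0$ is $1$. *)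

theory Defs
  imports Complex_Main "Jordan_Normal_Form.Matrix"
begin

text \<open>
  Conventions: a configuration \<open>(s\<^sub>1, \<dots>, s\<^sub>n)\<close> of bits is identified with the index
  \<open>2^(n - 1) * s\<^sub>1 + \<dots> + 2 * s\<^sub>(n-1) + s\<^sub>n\<close> in \<open>{0..<2^n}\<close>, i.e. the first cell is the most
  significant bit. This is the ordering for which the tensor product of matrices is the
  Kronecker product below. Rows are final, columns are initial configurations.
\<close>

definition kronecker :: "'a :: semiring_1 mat \<Rightarrow> 'a mat \<Rightarrow> 'a mat" (infixl "\<otimes>\<^sub>K" 70) where
  "A \<otimes>\<^sub>K B = mat (dim_row A * dim_row B) (dim_col A * dim_col B)
     (\<lambda>(i, j). A $$ (i div dim_row B, j div dim_col B) * B $$ (i mod dim_row B, j mod dim_col B))"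

text \<open>Bits are the natural numbers 0 and 1; the middle argument is the updated cell.\<close>

definition chi :: "nat \<Rightarrow> nat \<Rightarrow> nat \<Rightarrow> nat" where
  "chi w c e = (c + w + e + w * e) mod 2"

text \<open>
  An index \<open>i < 8\<close> encodes the triple \<open>(i div 4, i div 2 mod 2, i mod 2)\<close>.
\<close>

definition bulk :: "real mat" where
  "bulk = mat 8 8 (\<lambda>(i, j).
     of_bool (i div 4 = j div 4) *
     of_bool (i div 2 mod 2 = chi (j div 4) (j div 2 mod 2) (j mod 2)) *
     of_bool (i mod 2 = j mod 2))"

definition noise :: "real \<Rightarrow> real \<Rightarrow> real mat" where
  "noise a b = mat_of_rows_list 2 [[1 - a, b], [a, 1 - b]]"

text \<open>
  Averaging over the first cell (\<open>4 * s + i\<close> encodes \<open>s\<close> followed by the pair \<open>i\<close>), respectively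
  over the last cell (\<open>2 * i + s\<close> encodes the pair \<open>i\<close> followed by \<open>s\<close>).
\<close>

definition tilde_left :: "real mat" where
  "tilde_left = mat 4 4 (\<lambda>(i, j). 1 / 2 * (\<Sum>s = 0..1. bulk $$ (4 * s + i, 4 * s + j)))"

definition tilde_right :: "real mat" where
  "tilde_right = mat 4 4 (\<lambda>(i, j). 1 / 2 * (\<Sum>s = 0..1. bulk $$ (2 * i + s, 2 * j + s)))"

definition left_boundary :: "real \<Rightarrow> real \<Rightarrow> real mat" where
  "left_boundary a b = tilde_left * (noise a b \<otimes>\<^sub>K 1\<^sub>m 2)"

definition right_boundary :: "real \<Rightarrow> real \<Rightarrow> real mat" where
  "right_boundary c d = tilde_right * (1\<^sub>m 2 \<otimes>\<^sub>K noise c d)"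

text \<open>The bulk matrix acting on the cells \<open>k\<close>, \<open>k + 1\<close>, \<open>k + 2\<close>, for \<open>1 \<le> k \<le> n - 2\<close>.\<close>

definition bulk_at :: "nat \<Rightarrow> nat \<Rightarrow> real mat" where
  "bulk_at n k = 1\<^sub>m (2 ^ (k - 1)) \<otimes>\<^sub>K bulk \<otimes>\<^sub>K 1\<^sub>m (2 ^ (n - k - 2))"

definition left_at :: "nat \<Rightarrow> real \<Rightarrow> real \<Rightarrow> real mat" where
  "left_at n a b = left_boundary a b \<otimes>\<^sub>K 1\<^sub>m (2 ^ (n - 2))"

definition right_at :: "nat \<Rightarrow> real \<Rightarrow> real \<Rightarrow> real mat" where
  "right_at n c d = 1\<^sub>m (2 ^ (n - 2)) \<otimes>\<^sub>K right_boundary c d"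

text \<open>
  For even \<open>n\<close> the factors in \<open>U_even\<close> are those at \<open>k = 1, 3, \<dots>, n - 3\<close> from left to right,
  followed by the right boundary; those in \<open>U_odd\<close> are at \<open>k = n - 2, \<dots>, 4, 2\<close>, followed by the
  left boundary.
\<close>

definition U_even :: "nat \<Rightarrow> real \<Rightarrow> real \<Rightarrow> real mat" where
  "U_even n c d = foldr (\<lambda>k M. bulk_at n k * M) (filter odd [1..<n - 2]) (right_at n c d)"

definition U_odd :: "nat \<Rightarrow> real \<Rightarrow> real \<Rightarrow> real mat" where
  "U_odd n a b = foldr (\<lambda>k M. bulk_at n k * M) (rev (filter even [2..<n - 1])) (left_at n a b)"

definition propagator :: "nat \<Rightarrow> real \<Rightarrow> real \<Rightarrow> real \<Rightarrow> real \<Rightarrow> real mat" where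
  "propagator n a b c d = U_odd n a b * U_even n c d"

definition irreducible_mat :: "real mat \<Rightarrow> bool" where
  "irreducible_mat A \<longleftrightarrow>
     square_mat A \<and> (\<forall>x \<in> elements_mat A. 0 \<le> x) \<and>
     (\<forall>i < dim_row A. \<forall>j < dim_row A. \<exists>t > 0. (A ^\<^sub>m t) $$ (j, i) > 0)"

definition aperiodic_mat :: "real mat \<Rightarrow> bool" where
  "aperiodic_mat A \<longleftrightarrow> (\<exists>i < dim_row A. Gcd {t :: nat. 0 < t \<and> (A ^\<^sub>m t) $$ (i, i) > 0} = 1)"

end

theory Submission
  imports Defs
begin

text \<open>
  The boundary noise makes the first and the last cell arbitrary after each half step, so a positive
  entry of the propagator is a move of configurations in which only the boundary bits are chosen
  freely, the bulk updates \<open>c \<mapsto> c + (w \<or> e)\<close> being deterministic and reversible. For a fixed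
  pattern of boundary flips a move is a permutation of a finite set; hence reachability is symmetric,
  and one may run time backwards at will. The leftmost occupied cell can then always be moved to the
  right: it either moves there by itself, or it becomes the front of a soliton that escapes to the
  left. Such a soliton can be removed without changing the cells behind it: let it run to the
  boundary, absorb it, and run time back. So every configuration is connected to the empty one, which
  has a loop.
\<close>

section \<open>Configurations\<close>

text \<open>Predicates on all naturals, false off the cells: neighbours outside the chain read as
  empty, and equality of configurations is equality of functions.\<close>

definition confs :: "nat \<Rightarrow> (nat \<Rightarrow> bool) set" where
  "confs n = {f. \<forall>x. f x \<longrightarrow> 1 \<le> x \<and> x \<le> n}"

definition conf :: "nat \<Rightarrow> nat \<Rightarrow> nat \<Rightarrow> bool" where
  "conf n i = (\<lambda>x. 1 \<le> x \<and> x \<le> n \<and> bit i (n - x))"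

text \<open>The bit \<open>b\<close> toggles the cell rather than setting it, so that each fixed
  \<open>b\<close> gives a bijection.\<close>

definition flip :: "nat \<Rightarrow> bool \<Rightarrow> (nat \<Rightarrow> bool) \<Rightarrow> nat \<Rightarrow> bool" where
  "flip x b f = f(x := (f x \<noteq> b))"

definition sweep :: "nat set \<Rightarrow> (nat \<Rightarrow> bool) \<Rightarrow> nat \<Rightarrow> bool" where
  "sweep S f = (\<lambda>x. if x \<in> S then f x \<noteq> (f (x - 1) \<or> f (x + 1)) else f x)"

lemma finite_confs: "finite (confs n)"
proof -
  have "confs n \<subseteq> (\<lambda>X x. x \<in> X) ` Pow {1..n}"
  proof
    fix f assume "f \<in> confs n"
    then have "{x. f x} \<in> Pow {1..n}" "f = (\<lambda>x. x \<in> {x. f x})"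
      by (auto simp: confs_def)
    then show "f \<in> (\<lambda>X x. x \<in> X) ` Pow {1..n}" by blast
  qed
  then show ?thesis by (rule finite_subset) simp
qed

lemma conf_in_confs: "conf n i \<in> confs n"
  by (auto simp: conf_def confs_def)

lemma confs_obtain_index:
  assumes "f \<in> confs n"
  obtains i where "i < 2 ^ n" "conf n i = f"
proof
  let ?bs = "map (\<lambda>k. f (n - k)) [0..<n]"
  let ?i = "horner_sum of_bool 2 ?bs :: nat"
  show "?i < 2 ^ n"
    using horner_sum_of_bool_2_less[of ?bs] by simp
  show "conf n ?i = f"
    using assms by (auto simp: conf_def confs_def bit_horner_sum_bit_iff fun_eq_iff)
qed

lemma flip_in_confs: "\<lbrakk>f \<in> confs n; 1 \<le> x; x \<le> n\<rbrakk> \<Longrightarrow> flip x b f \<in> confs n"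
  by (auto simp: confs_def flip_def)

lemma sweep_in_confs: "\<lbrakk>f \<in> confs n; S \<subseteq> {1..n}\<rbrakk> \<Longrightarrow> sweep S f \<in> confs n"
  by (auto simp: confs_def sweep_def)

lemma flip_flip: "flip x b (flip x b f) = f"
  by (auto simp: flip_def fun_eq_iff)

text \<open>The neighbours of \<open>S\<close> are untouched, so the second pass toggles the same
  cells. As \<open>0 - 1 = 0\<close>, the assumption also keeps 0 out of \<open>S\<close>.\<close>

lemma sweep_sweep:
  assumes "\<And>x. x \<in> S \<Longrightarrow> x - 1 \<notin> S \<and> x + 1 \<notin> S"
  shows "sweep S (sweep S f) = f"
  using assms by (auto simp: sweep_def fun_eq_iff)

section \<open>Matrices realizing moves of configurations\<close>

text \<open>One-sided on purpose: entries off the graph of \<open>T\<close> may be positive too, so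
  one matrix can realize several moves. Nonnegativity prevents cancellation in products.\<close>

definition realizes :: "nat \<Rightarrow> real mat \<Rightarrow> ((nat \<Rightarrow> bool) \<Rightarrow> nat \<Rightarrow> bool) \<Rightarrow> bool" where
  "realizes n A T \<longleftrightarrow>
     A \<in> carrier_mat (2 ^ n) (2 ^ n) \<and> T \<in> confs n \<rightarrow> confs n \<and>
     (\<forall>i < 2 ^ n. \<forall>j < 2 ^ n. 0 \<le> A $$ (i, j) \<and> (conf n i = T (conf n j) \<longrightarrow> 0 < A $$ (i, j)))"

lemma realizesI:
  assumes "A \<in> carrier_mat (2 ^ n) (2 ^ n)"
    and "\<And>f. f \<in> confs n \<Longrightarrow> T f \<in> confs n"
    and "\<And>i j. i < 2 ^ n \<Longrightarrow> j < 2 ^ n \<Longrightarrow> 0 \<le> A $$ (i, j)"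
    and "\<And>i j. i < 2 ^ n \<Longrightarrow> j < 2 ^ n \<Longrightarrow> conf n i = T (conf n j) \<Longrightarrow> 0 < A $$ (i, j)"
  shows "realizes n A T"
  using assms by (auto simp: realizes_def)

text \<open>In the sum over intermediate configurations no term is negative, and the one at
  \<open>V (conf n j)\<close> is positive.\<close>

lemma realizes_mult:
  assumes A: "realizes n A T" and B: "realizes n B V"
  shows "realizes n (A * B) (T \<circ> V)"
proof (rule realizesI)
  have cA: "A \<in> carrier_mat (2 ^ n) (2 ^ n)" and cB: "B \<in> carrier_mat (2 ^ n) (2 ^ n)"
    using A B by (auto simp: realizes_def)
  then show "A * B \<in> carrier_mat (2 ^ n) (2 ^ n)" by simp
  have entry: "(A * B) $$ (i, j) = (\<Sum>k<2 ^ n. A $$ (i, k) * B $$ (k, j))"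
    if "i < 2 ^ n" "j < 2 ^ n" for i j
    using cA cB that by (simp add: scalar_prod_def atLeast0LessThan)
  show "(T \<circ> V) f \<in> confs n" if "f \<in> confs n" for f
    using A B that by (auto simp: realizes_def)
  fix i j :: nat assume ij: "i < 2 ^ n" "j < 2 ^ n"
  have nonneg: "0 \<le> A $$ (i, k) * B $$ (k, j)" if "k < 2 ^ n" for k
    using A B ij that by (simp add: realizes_def)
  then show "0 \<le> (A * B) $$ (i, j)"
    unfolding entry[OF ij] by (intro sum_nonneg) simp
  assume eq: "conf n i = (T \<circ> V) (conf n j)"
  have "V (conf n j) \<in> confs n"
    using B conf_in_confs by (auto simp: realizes_def)
  then obtain k where k: "k < 2 ^ n" "conf n k = V (conf n j)"
    by (rule confs_obtain_index)
  then have "0 < A $$ (i, k) * B $$ (k, j)"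
    using A B ij eq by (simp add: realizes_def)
  then show "0 < (A * B) $$ (i, j)"
    using k nonneg unfolding entry[OF ij] by (intro sum_pos2[of _ k]) auto
qed

lemma conf_inj:
  assumes "conf n i = conf n j" "i < 2 ^ n" "j < 2 ^ n"
  shows "i = j"
proof (rule bit_eqI)
  fix k
  show "bit i k \<longleftrightarrow> bit j k"
  proof (cases "k < n")
    case True
    then show ?thesis
      using fun_cong[OF assms(1), of "n - k"] by (simp add: conf_def Suc_le_eq)
  next
    case False
    then have "i < 2 ^ k" "j < 2 ^ k"
      using assms(2,3) by (meson le_less_trans less_le_trans not_le one_le_numeral power_increasing)+
    then show ?thesis by (simp add: bit_iff_odd)
  qed
qed

lemma realizes_one: "realizes n (1\<^sub>m (2 ^ n)) id"
  by (rule realizesI) (auto dest: conf_inj)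

lemma realizes_foldr:
  assumes "realizes n M V" and "\<And>k. k \<in> set ks \<Longrightarrow> realizes n (A k) (T k)"
  shows "realizes n (foldr (\<lambda>k M. A k * M) ks M) (foldr (\<lambda>k. T k) ks \<circ> V)"
  using assms(2)
proof (induction ks)
  case Nil
  then show ?case using assms(1) by simp
next
  case (Cons k ks)
  then have "realizes n (A k * foldr (\<lambda>k M. A k * M) ks M) (T k \<circ> (foldr (\<lambda>k. T k) ks \<circ> V))"
    by (intro realizes_mult) (use Cons in \<open>auto simp: comp_def\<close>)
  then show ?case by (simp add: comp_def)
qed

text \<open>Sweeping \<open>S\<close> changes neither \<open>a\<close> nor its neighbours, so the
  later update of \<open>a\<close> reads the original values.\<close>

lemma sweep_insert:
  assumes "a \<notin> S" "a - 1 \<notin> S" "a + 1 \<notin> S"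
  shows "sweep {a} (sweep S f) = sweep (insert a S) f"
  using assms by (auto simp: sweep_def fun_eq_iff)

lemma foldr_sweep_singletons:
  assumes "distinct xs" and "\<And>x. x \<in> set xs \<Longrightarrow> x - 1 \<notin> set xs \<and> x + 1 \<notin> set xs"
  shows "foldr (\<lambda>x. sweep {x}) xs = sweep (set xs)"
  using assms
proof (induction xs)
  case Nil
  then show ?case by (auto simp: sweep_def fun_eq_iff)
next
  case (Cons a xs)
  then have "foldr (\<lambda>x. sweep {x}) xs = sweep (set xs)" by auto
  moreover have "a \<notin> set xs" "a - 1 \<notin> set xs" "a + 1 \<notin> set xs"
    using Cons.prems by auto
  ultimately show ?case
    by (intro ext) (simp only: foldr.simps list.set comp_apply sweep_insert not_False_eq_True)
qed

section \<open>The factors of the propagator\<close>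

lemma nat_less_4: "i < 4 \<longleftrightarrow> i = 0 \<or> i = 1 \<or> i = 2 \<or> i = (3::nat)"
  by auto

lemma lessThan_4: "{0..<4} = {0, 1, 2, 3::nat}"
  by auto

text \<open>If the second cell is occupied (\<open>j\<close> odd), the first one toggles whatever
  the averaged cell holds; if it is empty, the averaged cell decides and both outcomes get weight
  1/2.\<close>

lemma tilde_left_entry:
  assumes "i < 4" "j < 4"
  shows "tilde_left $$ (i, j) =
    (if i mod 2 \<noteq> j mod 2 then 0 else if odd j then of_bool (i div 2 \<noteq> j div 2) else 1 / 2)"
  using assms unfolding nat_less_4
  by (elim disjE) (simp_all add: tilde_left_def bulk_def chi_def)

lemma tilde_right_entry:
  assumes "i < 4" "j < 4"
  shows "tilde_right $$ (i, j) =
    (if i div 2 \<noteq> j div 2 then 0 else if 2 \<le> j then of_bool (i mod 2 \<noteq> j mod 2) else 1 / 2)"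
  using assms unfolding nat_less_4
  by (elim disjE) (simp_all add: tilde_right_def bulk_def chi_def)

lemma noise_entry:
  "noise a b $$ (0, 0) = 1 - a" "noise a b $$ (0, Suc 0) = b"
  "noise a b $$ (Suc 0, 0) = a" "noise a b $$ (Suc 0, Suc 0) = 1 - b"
  by (simp_all add: noise_def mat_of_rows_list_def)

lemma noise_dim [simp]: "dim_row (noise a b) = 2" "dim_col (noise a b) = 2"
  by (simp_all add: noise_def mat_of_rows_list_def)

lemma tilde_left_dim [simp]: "dim_row tilde_left = 4" "dim_col tilde_left = 4"
  by (simp_all add: tilde_left_def)

lemma tilde_right_dim [simp]: "dim_row tilde_right = 4" "dim_col tilde_right = 4"
  by (simp_all add: tilde_right_def)

lemma kronecker_dim [simp]:
  "dim_row (A \<otimes>\<^sub>K B) = dim_row A * dim_row B" "dim_col (A \<otimes>\<^sub>K B) = dim_col A * dim_col B"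
  by (simp_all add: kronecker_def)

lemma left_boundary_entry:
  assumes "0 < a" "a < 1" "0 < b" "b < 1" "i < 4" "j < 4"
  shows "0 \<le> left_boundary a b $$ (i, j)"
    and "i mod 2 = j mod 2 \<Longrightarrow> 0 < left_boundary a b $$ (i, j)"
proof -
  have "left_boundary a b $$ (i, j)
      = (\<Sum>k\<in>{0, 1, 2, 3}. tilde_left $$ (i, k) * (noise a b \<otimes>\<^sub>K 1\<^sub>m 2) $$ (k, j))"
    using assms(5,6) by (simp add: left_boundary_def scalar_prod_def lessThan_4)
  \<comment> \<open>For even \<open>j\<close> averaging a noise column of sum 1 leaves 1/2. For odd
    \<open>j\<close> the first cell toggles after the noise, so \<open>1 - i div 2\<close> is its
    value in between.\<close>
  also have "\<dots> = (if i mod 2 \<noteq> j mod 2 then 0 else if even j then 1 / 2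
      else noise a b $$ (1 - i div 2, j div 2))"
    using assms(5,6) unfolding nat_less_4
    by (elim disjE) (simp_all add: tilde_left_entry kronecker_def noise_entry field_simps)
  finally have e: "left_boundary a b $$ (i, j) = \<dots>" .
  show "0 \<le> left_boundary a b $$ (i, j)"
    unfolding e using assms unfolding nat_less_4 by (elim disjE) (simp_all add: noise_entry)
  show "0 < left_boundary a b $$ (i, j)" if "i mod 2 = j mod 2"
    unfolding e using assms that unfolding nat_less_4 by (elim disjE) (simp_all add: noise_entry)
qed

lemma right_boundary_entry:
  assumes "0 < c" "c < 1" "0 < d" "d < 1" "i < 4" "j < 4"
  shows "0 \<le> right_boundary c d $$ (i, j)"
    and "i div 2 = j div 2 \<Longrightarrow> 0 < right_boundary c d $$ (i, j)"
proof -
  have "right_boundary c d $$ (i, j)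
      = (\<Sum>k\<in>{0, 1, 2, 3}. tilde_right $$ (i, k) * (1\<^sub>m 2 \<otimes>\<^sub>K noise c d) $$ (k, j))"
    using assms(5,6) by (simp add: right_boundary_def scalar_prod_def lessThan_4)
  also have "\<dots> = (if i div 2 \<noteq> j div 2 then 0 else if j < 2 then 1 / 2
      else noise c d $$ (1 - i mod 2, j mod 2))"
    using assms(5,6) unfolding nat_less_4
    by (elim disjE) (simp_all add: tilde_right_entry kronecker_def noise_entry field_simps)
  finally have e: "right_boundary c d $$ (i, j) = \<dots>" .
  show "0 \<le> right_boundary c d $$ (i, j)"
    unfolding e using assms unfolding nat_less_4 by (elim disjE) (simp_all add: noise_entry)
  show "0 < right_boundary c d $$ (i, j)" if "i div 2 = j div 2"
    unfolding e using assms that unfolding nat_less_4 by (elim disjE) (simp_all add: noise_entry)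
qed

section \<open>Kronecker products and binary digits of indices\<close>

lemma kronecker_carrier:
  "A \<in> carrier_mat a b \<Longrightarrow> B \<in> carrier_mat c d \<Longrightarrow> A \<otimes>\<^sub>K B \<in> carrier_mat (a * c) (b * d)"
  by (auto simp: kronecker_def)

lemma kronecker_index:
  assumes "A \<in> carrier_mat a b" "B \<in> carrier_mat c d" "i < a * c" "j < b * d"
  shows "(A \<otimes>\<^sub>K B) $$ (i, j) = A $$ (i div c, j div d) * B $$ (i mod c, j mod d)"
  using assms by (auto simp: kronecker_def)

lemma div_exp_eq_if_bits_eq:
  fixes i j :: nat
  assumes "\<And>m. b \<le> m \<Longrightarrow> bit i m = bit j m"
  shows "i div 2 ^ b = j div 2 ^ b"
  using assms unfolding drop_bit_eq_div[symmetric] by (auto simp: bit_eq_iff bit_drop_bit_eq)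

lemma mod_exp_eq_if_bits_eq:
  fixes i j :: nat
  assumes "\<And>m. m < b \<Longrightarrow> bit i m = bit j m"
  shows "i mod 2 ^ b = j mod 2 ^ b"
  using assms unfolding take_bit_eq_mod[symmetric] by (auto simp: bit_eq_iff bit_take_bit_iff)

lemma not_bit_beyond:
  fixes i :: nat
  assumes "i < 2 ^ n" "n \<le> m"
  shows "\<not> bit i m"
proof -
  have "i < 2 ^ m"
    using assms by (meson less_le_trans one_le_numeral power_increasing)
  then show ?thesis by (simp add: bit_iff_odd)
qed

lemma bit_eq_conf: "m < n \<Longrightarrow> bit i m = conf n i (n - m)"
  by (simp add: conf_def Suc_le_eq)

lemma mod_8_eq:
  "q mod 8 div 4 = of_bool (odd (q div 4))"
  "q mod 8 div 2 mod 2 = of_bool (odd (q div 2))"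
  "q mod 8 mod 2 = of_bool (odd q)" for q :: nat
  unfolding of_bool_def by presburger+

text \<open>Modulo 2 the polynomial \<open>w + e + w * e\<close> is the disjunction of
  \<open>w\<close> and \<open>e\<close>.\<close>

lemma chi_of_bool: "chi (of_bool w) (of_bool c) (of_bool e) = of_bool (c \<noteq> (w \<or> e))"
  by (cases w; cases c; cases e) (simp_all add: chi_def)

lemma bulk_entry_pos:
  assumes "odd (p div 4) = odd (q div 4)" "odd p = odd q"
    and "odd (p div 2) = (odd (q div 2) \<noteq> (odd (q div 4) \<or> odd q))"
  shows "0 < bulk $$ (p mod 8, q mod 8)"
  using assms by (simp add: bulk_def mod_8_eq chi_of_bool)

lemma bulk_carrier: "bulk \<in> carrier_mat 8 8"
  by (simp add: bulk_def)

lemma bulk_entry_nonneg: "i < 8 \<Longrightarrow> j < 8 \<Longrightarrow> 0 \<le> bulk $$ (i, j)"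
  by (simp add: bulk_def)

lemma realizes_bulk_at:
  assumes "1 \<le> k" "k + 2 \<le> n"
  shows "realizes n (bulk_at n k) (sweep {Suc k})"
proof (rule realizesI)
  \<comment> \<open>There are \<open>b\<close> cells to the right of the triple, so in the index the
    triple occupies the digits \<open>b + 2\<close>, \<open>b + 1\<close>, \<open>b\<close>, and the
    updated middle cell is the digit \<open>b + 1\<close>.\<close>
  define b where "b = n - k - 2"
  have n: "n = k - 1 + 3 + b"
    using assms by (simp add: b_def)
  have card: "(2::nat) ^ n = 2 ^ (k - 1) * 8 * 2 ^ b"
    unfolding n power_add by simp
  have c1: "1\<^sub>m (2 ^ (k - 1)) \<otimes>\<^sub>K bulk \<in> carrier_mat (2 ^ (k - 1) * 8) (2 ^ (k - 1) * 8)"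
    by (rule kronecker_carrier) (simp_all add: bulk_carrier)
  show "bulk_at n k \<in> carrier_mat (2 ^ n) (2 ^ n)"
    unfolding bulk_at_def card b_def[symmetric] by (rule kronecker_carrier[OF c1]) simp
  show "sweep {Suc k} f \<in> confs n" if "f \<in> confs n" for f
    using that assms by (intro sweep_in_confs) auto
  fix i j :: nat assume ij: "i < 2 ^ n" "j < 2 ^ n"
  have lt: "i div 2 ^ b < 2 ^ (k - 1) * 8" "j div 2 ^ b < 2 ^ (k - 1) * 8"
    using ij unfolding card by (simp_all add: less_mult_imp_div_less)
  have "bulk_at n k $$ (i, j) = (1\<^sub>m (2 ^ (k - 1)) \<otimes>\<^sub>K bulk) $$ (i div 2 ^ b, j div 2 ^ b)
      * 1\<^sub>m (2 ^ b) $$ (i mod 2 ^ b, j mod 2 ^ b)"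
    unfolding bulk_at_def b_def[symmetric]
    by (rule kronecker_index[OF c1]) (use ij card in simp_all)
  also have "(1\<^sub>m (2 ^ (k - 1)) \<otimes>\<^sub>K bulk) $$ (i div 2 ^ b, j div 2 ^ b)
      = 1\<^sub>m (2 ^ (k - 1)) $$ (i div 2 ^ b div 8, j div 2 ^ b div 8)
        * bulk $$ (i div 2 ^ b mod 8, j div 2 ^ b mod 8)"
    by (rule kronecker_index[OF one_carrier_mat bulk_carrier lt])
  also have "1\<^sub>m (2 ^ (k - 1)) $$ (i div 2 ^ b div 8, j div 2 ^ b div 8)
      = (of_bool (i div 2 ^ b div 8 = j div 2 ^ b div 8) :: real)"
    using lt by (simp add: less_mult_imp_div_less)
  finally have entry: "bulk_at n k $$ (i, j) = of_bool (i div 2 ^ b div 8 = j div 2 ^ b div 8)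
      * bulk $$ (i div 2 ^ b mod 8, j div 2 ^ b mod 8) * of_bool (i mod 2 ^ b = j mod 2 ^ b)"
    by simp
  show "0 \<le> bulk_at n k $$ (i, j)"
    unfolding entry by (simp add: bulk_entry_nonneg)
  assume eq: "conf n i = sweep {Suc k} (conf n j)"
  have bits: "bit i m = (if m = b + 1 then bit j (b + 1) \<noteq> (bit j (b + 2) \<or> bit j b) else bit j m)"
    for m
  proof (cases "m < n")
    case True
    have "bit i m = sweep {Suc k} (conf n j) (n - m)"
      using bit_eq_conf[OF True] eq by simp
    moreover have "n - m = Suc k \<longleftrightarrow> m = b + 1"
      using True assms by (auto simp: b_def)
    moreover have "conf n j k = bit j (b + 2)" "conf n j (Suc k) = bit j (b + 1)"
      "conf n j (Suc (Suc k)) = bit j b"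
    proof -
      have "n - k = b + 2" "n - Suc k = b + 1" "n - Suc (Suc k) = b"
        using assms by (auto simp: b_def)
      then show "conf n j k = bit j (b + 2)" "conf n j (Suc k) = bit j (b + 1)"
        "conf n j (Suc (Suc k)) = bit j b"
        using assms by (simp_all add: conf_def)
    qed
    ultimately show ?thesis
      by (cases "m = b + 1") (simp_all add: sweep_def bit_eq_conf[OF True])
  next
    case False
    then show ?thesis
      using not_bit_beyond[OF ij(1), of m] not_bit_beyond[OF ij(2), of m] n by simp
  qed
  have "i div 2 ^ b div 8 = j div 2 ^ b div 8"
    using div_exp_eq_if_bits_eq[of "b + 3" i j] bits by (simp add: power_add div_mult2_eq)
  moreover have "i mod 2 ^ b = j mod 2 ^ b"
    by (rule mod_exp_eq_if_bits_eq) (simp add: bits)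
  moreover have "0 < bulk $$ (i div 2 ^ b mod 8, j div 2 ^ b mod 8)"
  proof (rule bulk_entry_pos)
    have pow: "2 ^ (b + 1) = 2 ^ b * (2::nat)" "2 ^ (b + 2) = 2 ^ b * (4::nat)"
      by (simp_all add: power_add)
    have shift: "odd (x div 2 ^ b) = bit x b" "odd (x div 2 ^ b div 2) = bit x (b + 1)"
      "odd (x div 2 ^ b div 4) = bit x (b + 2)" for x :: nat
      by (simp_all only: bit_iff_odd pow div_mult2_eq)
    show "odd (i div 2 ^ b div 4) = odd (j div 2 ^ b div 4)" "odd (i div 2 ^ b) = odd (j div 2 ^ b)"
      "odd (i div 2 ^ b div 2) =
        (odd (j div 2 ^ b div 2) \<noteq> (odd (j div 2 ^ b div 4) \<or> odd (j div 2 ^ b)))"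
      unfolding shift by (simp_all add: bits)
  qed
  ultimately show "0 < bulk_at n k $$ (i, j)"
    unfolding entry by simp
qed

lemma left_boundary_carrier: "left_boundary a b \<in> carrier_mat 4 4"
  by (intro carrier_matI) (simp_all add: left_boundary_def)

lemma right_boundary_carrier: "right_boundary c d \<in> carrier_mat 4 4"
  by (intro carrier_matI) (simp_all add: right_boundary_def)

text \<open>The boundary block is positive whenever all cells but the first agree, so the same
  matrix realizes both values of \<open>v\<close>.\<close>

lemma realizes_left_at:
  assumes "2 \<le> n" "0 < a" "a < 1" "0 < b" "b < 1"
  shows "realizes n (left_at n a b) (flip 1 v)"
proof (rule realizesI)
  define m where "m = n - 2"
  have n: "n = 2 + m"
    using assms by (simp add: m_def)
  have card: "(2::nat) ^ n = 4 * 2 ^ m"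
    unfolding n power_add by simp
  show "left_at n a b \<in> carrier_mat (2 ^ n) (2 ^ n)"
    unfolding left_at_def card m_def[symmetric]
    by (intro kronecker_carrier left_boundary_carrier one_carrier_mat)
  show "flip 1 v f \<in> confs n" if "f \<in> confs n" for f
    using that assms by (intro flip_in_confs) auto
  fix i j :: nat assume ij: "i < 2 ^ n" "j < 2 ^ n"
  have lt: "i div 2 ^ m < 4" "j div 2 ^ m < 4"
    using ij unfolding card by (simp_all add: less_mult_imp_div_less)
  have entry: "left_at n a b $$ (i, j)
      = left_boundary a b $$ (i div 2 ^ m, j div 2 ^ m) * 1\<^sub>m (2 ^ m) $$ (i mod 2 ^ m, j mod 2 ^ m)"
    unfolding left_at_def m_def[symmetric]
    by (rule kronecker_index[OF left_boundary_carrier one_carrier_mat]) (use ij card in simp_all)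
  show "0 \<le> left_at n a b $$ (i, j)"
    unfolding entry using left_boundary_entry(1)[OF assms(2-) lt] by simp
  assume eq: "conf n i = flip 1 v (conf n j)"
  have bits: "bit i k = bit j k" if "k \<le> m" for k
  proof -
    have "k < n" "n - k \<noteq> 1"
      using that n by auto
    then show ?thesis
      by (simp only: bit_eq_conf eq flip_def fun_upd_apply if_False)
  qed
  have "i mod 2 ^ m = j mod 2 ^ m"
    by (rule mod_exp_eq_if_bits_eq) (simp add: bits)
  moreover have "i div 2 ^ m mod 2 = j div 2 ^ m mod 2"
    using bits[of m] by (simp add: bit_iff_odd mod2_eq_if)
  ultimately show "0 < left_at n a b $$ (i, j)"
    unfolding entry using left_boundary_entry(2)[OF assms(2-) lt] by simp
qed

lemma realizes_right_at:
  assumes "2 \<le> n" "0 < c" "c < 1" "0 < d" "d < 1"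
  shows "realizes n (right_at n c d) (flip n v)"
proof (rule realizesI)
  define m where "m = n - 2"
  have n: "n = m + 2"
    using assms by (simp add: m_def)
  have card: "(2::nat) ^ n = 2 ^ m * 4"
    unfolding n power_add by simp
  show "right_at n c d \<in> carrier_mat (2 ^ n) (2 ^ n)"
    unfolding right_at_def card m_def[symmetric]
    by (intro kronecker_carrier right_boundary_carrier one_carrier_mat)
  show "flip n v f \<in> confs n" if "f \<in> confs n" for f
    using that assms by (intro flip_in_confs) auto
  fix i j :: nat assume ij: "i < 2 ^ n" "j < 2 ^ n"
  have lt: "i mod 4 < 4" "j mod 4 < 4"
    by simp_all
  have dlt: "i div 4 < 2 ^ m" "j div 4 < 2 ^ m"
    using ij unfolding card by (simp_all add: less_mult_imp_div_less)
  have entry: "right_at n c d $$ (i, j)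
      = 1\<^sub>m (2 ^ m) $$ (i div 4, j div 4) * right_boundary c d $$ (i mod 4, j mod 4)"
    unfolding right_at_def m_def[symmetric]
    by (rule kronecker_index[OF one_carrier_mat right_boundary_carrier]) (use ij card in simp_all)
  show "0 \<le> right_at n c d $$ (i, j)"
    unfolding entry using right_boundary_entry(1)[OF assms(2-) lt] dlt by simp
  assume eq: "conf n i = flip n v (conf n j)"
  have bits: "bit i k = bit j k" if "1 \<le> k" for k
  proof (cases "k < n")
    case True
    with that have "n - k \<noteq> n" by auto
    with True show ?thesis
      by (simp only: bit_eq_conf eq flip_def fun_upd_apply if_False)
  next
    case False
    then show ?thesis
      using not_bit_beyond ij by simp
  qed
  have "i div 2 = j div 2"
    using div_exp_eq_if_bits_eq[of 1 i j] bits by simp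
  moreover have "x div 4 = x div 2 div 2" "x mod 4 div 2 = x div 2 mod 2" for x :: nat
    using mod_mult2_eq[of x 2 2] by (simp_all flip: div_mult2_eq)
  ultimately have "i div 4 = j div 4" "i mod 4 div 2 = j mod 4 div 2"
    by simp_all
  then show "0 < right_at n c d $$ (i, j)"
    unfolding entry using right_boundary_entry(2)[OF assms(2-) lt] dlt by simp
qed

section \<open>The half steps as simultaneous updates\<close>

definition even_sites :: "nat \<Rightarrow> nat set" where
  "even_sites n = {x. even x \<and> 1 < x \<and> x < n}"

definition odd_sites :: "nat \<Rightarrow> nat set" where
  "odd_sites n = {x. odd x \<and> 1 < x \<and> x < n}"

text \<open>The bits \<open>v\<close> and \<open>w\<close> stand for the random outcomes at the
  first and last cell. The rightmost matrix factor acts first, hence the last cell comes before the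
  even sites.\<close>

definition step :: "nat \<Rightarrow> bool \<Rightarrow> bool \<Rightarrow> (nat \<Rightarrow> bool) \<Rightarrow> nat \<Rightarrow> bool" where
  "step n v w f = sweep (odd_sites n) (flip 1 v (sweep (even_sites n) (flip n w f)))"

text \<open>No two bulk factors of a half step update adjacent cells, so their ordered product
  amounts to one simultaneous sweep.\<close>

lemma realizes_sweeps:
  assumes "realizes n M V" and "distinct ks"
    and "\<And>k. k \<in> set ks \<Longrightarrow> 1 \<le> k \<and> k + 2 \<le> n \<and> Suc k \<notin> set ks"
  shows "realizes n (foldr (\<lambda>k M. bulk_at n k * M) ks M) (sweep (Suc ` set ks) \<circ> V)"
proof -
  have "foldr (\<lambda>k. sweep {Suc k}) ks = foldr (\<lambda>x. sweep {x}) (map Suc ks)"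
    by (induction ks) simp_all
  also have "\<dots> = sweep (set (map Suc ks))"
    using assms(2,3) by (intro foldr_sweep_singletons) (auto simp: distinct_map)
  finally have "foldr (\<lambda>k. sweep {Suc k}) ks = sweep (Suc ` set ks)" by simp
  then show ?thesis
    using realizes_foldr[OF assms(1), of ks "bulk_at n" "\<lambda>k. sweep {Suc k}"]
      realizes_bulk_at assms(3) by simp
qed

lemma realizes_propagator:
  assumes "even n" "4 \<le> n" "0 < a" "a < 1" "0 < b" "b < 1" "0 < c" "c < 1" "0 < d" "d < 1"
  shows "realizes n (propagator n a b c d) (step n v w)"
proof -
  have "realizes n (U_even n c d)
      (sweep (Suc ` set (filter odd [1..<n - 2])) \<circ> flip n w)"
    unfolding U_even_def using assms
    by (intro realizes_sweeps realizes_right_at) auto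
  moreover have "Suc ` set (filter odd [1..<n - 2]) = even_sites n"
  proof (rule Set.set_eqI)
    show "x \<in> Suc ` set (filter odd [1..<n - 2]) \<longleftrightarrow> x \<in> even_sites n" for x
    proof (cases x)
      case 0
      then show ?thesis by (auto simp: even_sites_def)
    next
      case (Suc y)
      then have "x \<in> Suc ` set (filter odd [1..<n - 2]) \<longleftrightarrow> odd y \<and> 1 \<le> y \<and> y < n - 2"
        by auto
      also have "\<dots> \<longleftrightarrow> x \<in> even_sites n"
        unfolding even_sites_def Suc mem_Collect_eq using assms(1,2) by presburger
      finally show ?thesis .
    qed
  qed
  moreover have "realizes n (U_odd n a b)
      (sweep (Suc ` set (rev (filter even [2..<n - 1]))) \<circ> flip 1 v)"
    unfolding U_odd_def using assms
    by (intro realizes_sweeps realizes_left_at) auto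
  moreover have "Suc ` set (rev (filter even [2..<n - 1])) = odd_sites n"
  proof (rule Set.set_eqI)
    show "x \<in> Suc ` set (rev (filter even [2..<n - 1])) \<longleftrightarrow> x \<in> odd_sites n" for x
    proof (cases x)
      case 0
      then show ?thesis by (auto simp: odd_sites_def)
    next
      case (Suc y)
      then have "x \<in> Suc ` set (rev (filter even [2..<n - 1])) \<longleftrightarrow> even y \<and> 2 \<le> y \<and> y < n - 1"
        by auto
      also have "\<dots> \<longleftrightarrow> x \<in> odd_sites n"
        unfolding odd_sites_def Suc mem_Collect_eq using assms(1,2) by presburger
      finally show ?thesis .
    qed
  qed
  moreover have "step n v w
      = (sweep (odd_sites n) \<circ> flip 1 v) \<circ> (sweep (even_sites n) \<circ> flip n w)"
    by (simp add: step_def fun_eq_iff)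
  ultimately show ?thesis
    unfolding propagator_def using realizes_mult by metis
qed

section \<open>Reachability\<close>

definition reach :: "nat \<Rightarrow> (nat \<Rightarrow> bool) \<Rightarrow> (nat \<Rightarrow> bool) \<Rightarrow> bool" where
  "reach n = (\<lambda>f g. \<exists>v w. g = step n v w f)\<^sup>*\<^sup>*"

lemma even_sweep_apply:
  "sweep (even_sites n) f x =
    (if even x \<and> 1 < x \<and> x < n then f x \<noteq> (f (x - 1) \<or> f (x + 1)) else f x)"
  by (simp add: sweep_def even_sites_def)

lemma odd_sweep_apply:
  "sweep (odd_sites n) f x =
    (if odd x \<and> 1 < x \<and> x < n then f x \<noteq> (f (x - 1) \<or> f (x + 1)) else f x)"
  by (simp add: sweep_def odd_sites_def)

lemma even_sweep_sweep [simp]: "sweep (even_sites n) (sweep (even_sites n) f) = f"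
  by (rule sweep_sweep) (auto simp: even_sites_def)

lemma odd_sweep_sweep [simp]: "sweep (odd_sites n) (sweep (odd_sites n) f) = f"
  by (rule sweep_sweep) (auto simp: odd_sites_def)

lemma even_sweep_in_confs: "f \<in> confs n \<Longrightarrow> sweep (even_sites n) f \<in> confs n"
  by (rule sweep_in_confs) (auto simp: even_sites_def)

lemma odd_sweep_in_confs: "f \<in> confs n \<Longrightarrow> sweep (odd_sites n) f \<in> confs n"
  by (rule sweep_in_confs) (auto simp: odd_sites_def)

lemma flip_False [simp]: "flip x False f = f"
  by (auto simp: flip_def fun_eq_iff)

lemma step_in_confs: "\<lbrakk>f \<in> confs n; 1 \<le> n\<rbrakk> \<Longrightarrow> step n v w f \<in> confs n"
  unfolding step_def by (intro odd_sweep_in_confs flip_in_confs even_sweep_in_confs) auto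

text \<open>All four factors are involutions; applied in reverse order they give a left
  inverse.\<close>

lemma inj_step: "inj (step n v w)"
proof (rule inj_on_inverseI)
  fix f
  show "flip n w (sweep (even_sites n) (flip 1 v (sweep (odd_sites n) (step n v w f)))) = f"
    by (simp add: step_def flip_flip del: One_nat_def)
qed

lemma reach_refl: "reach n f f"
  by (simp add: reach_def)

lemma reach_trans: "reach n f g \<Longrightarrow> reach n g h \<Longrightarrow> reach n f h"
  by (simp add: reach_def)

lemma reach_step: "reach n f (step n v w f)"
  unfolding reach_def by (rule r_into_rtranclp) blast

lemma reach_funpow_step: "reach n f ((step n v w ^^ k) f)"
  by (induction k) (auto intro: reach_refl reach_trans reach_step)

lemma funpow_step_in_confs:
  "\<lbrakk>f \<in> confs n; 1 \<le> n\<rbrakk> \<Longrightarrow> (step n v w ^^ k) f \<in> confs n"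
  by (induction k) (auto intro: step_in_confs)

text \<open>For fixed boundary flips a step is a permutation of a finite set, hence has finite order.\<close>

lemma reach_step_back:
  assumes "f \<in> confs n" "1 \<le> n"
  shows "reach n (step n v w f) f"
proof -
  have "finite {g. \<exists>k. g = (step n v w ^^ k) f}"
    by (rule finite_subset[OF _ finite_confs[of n]]) (use assms funpow_step_in_confs in auto)
  then obtain k where k: "0 < k" "(step n v w ^^ k) f = f"
    using funpow_inj_finite[OF inj_step] by metis
  then have "(step n v w ^^ (k - 1)) (step n v w f) = f"
    by (cases k) (simp_all add: funpow_swap1)
  then show ?thesis
    using reach_funpow_step[of n "step n v w f" "k - 1" v w] by simp
qed

text \<open>A path is reversed step by step; membership in \<open>confs n\<close> is carried along
  because \<open>reach_step_back\<close> requires it.\<close>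

lemma reach_sym:
  assumes "reach n f g" "f \<in> confs n" "1 \<le> n"
  shows "reach n g f \<and> g \<in> confs n"
  using assms(1) unfolding reach_def
proof (induction rule: rtranclp_induct)
  case base
  then show ?case using assms by simp
next
  case (step g h)
  then obtain v w where "h = step n v w g" by blast
  with step.IH have "reach n h g" "h \<in> confs n"
    using assms(3) by (auto intro: reach_step_back step_in_confs)
  with step.IH show ?case
    unfolding reach_def by auto
qed

section \<open>Moves near the left boundary\<close>

lemma reach_deterministic_step:
  "reach n f (sweep (odd_sites n) (sweep (even_sites n) f))"
  using reach_step[of n f False False] by (simp add: step_def)

text \<open>The odd sweep neither reads nor writes cell 1. Hence \<open>f\<close> and
  \<open>flip 1 v f\<close> are both successors of one configuration \<open>h\<close>, and
  reversibility joins them.\<close>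

lemma reach_flip_first:
  assumes f: "f \<in> confs n" and n: "1 \<le> n"
  shows "reach n f (flip 1 v f)"
proof -
  define h where "h = sweep (even_sites n) (sweep (odd_sites n) f)"
  have "flip 1 v (sweep (odd_sites n) f) = sweep (odd_sites n) (flip 1 v f)"
    by (auto simp: flip_def sweep_def odd_sites_def fun_eq_iff elim!: oddE)
  then have "step n v False h = flip 1 v f"
    by (simp add: step_def h_def del: One_nat_def)
  moreover have "step n False False h = f"
    by (simp add: step_def h_def)
  moreover have "h \<in> confs n"
    unfolding h_def using f by (intro even_sweep_in_confs odd_sweep_in_confs)
  ultimately show ?thesis
    using reach_step[of n h v False] reach_step_back[of h n False False] n
    by (metis reach_trans)
qed

text \<open>
  The first two cells can be erased when the third one is empty: the configurations before and
  after flipping the first cell in the middle of a step have a common successor.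
\<close>

lemma reach_clear_first_two:
  assumes f: "f \<in> confs n" and n: "4 \<le> n" and f3: "\<not> f 3"
  shows "reach n f (f(1 := False, 2 := False))"
proof -
  have clear1: "reach n g (g(1 := False))" if "g \<in> confs n" for g
    using reach_flip_first[OF that, of "g 1"] n by (auto simp: flip_def)
  show ?thesis
  proof (cases "f 2")
    case False
    then have "f(1 := False, 2 := False) = f(1 := False)"
      by (auto simp: fun_eq_iff)
    then show ?thesis using clear1[OF f] by simp
  next
    case True
    \<comment> \<open>Toggling the first cell between its half steps gives \<open>g\<close> the same
      successor as \<open>f\<close>. As cell 3 is empty, cell 2 depends on cell 1 alone; the two
      even sweeps see opposite values of cell 1, so cell 2 changes.\<close>
    define g where "g = sweep (even_sites n) (flip 1 True (sweep (even_sites n) f))"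
    have gc: "g \<in> confs n"
      unfolding g_def using f n by (intro even_sweep_in_confs flip_in_confs) auto
    have "step n True False g = step n False False f"
      by (simp add: step_def g_def flip_flip del: One_nat_def)
    then have "reach n f g"
      using reach_step[of n f False False] reach_step_back[OF gc, of True False] n
      by (metis reach_trans le_trans one_le_numeral)
    moreover have "g(1 := False) = f(1 := False, 2 := False)"
    proof
      fix x :: nat
      have "x = 1 \<or> x = 2 \<or> odd x \<and> x \<noteq> 1 \<or> x = 0 \<or> even x \<and> 4 \<le> x"
        by presburger
      then consider "x = 1" | "x = 2" | "odd x" "x \<noteq> 1" | "x = 0" | "even x" "4 \<le> x"
        by blast
      then show "(g(1 := False)) x = (f(1 := False, 2 := False)) x"
        using n f3 True
        by cases (auto simp: g_def sweep_def flip_def even_sites_def numeral_3_eq_3)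
    qed
    ultimately show ?thesis
      using clear1[OF gc] by (metis reach_trans)
  qed
qed

text \<open>
  The pair \<open>(k - 1, k)\<close> is a soliton running to the left with nothing ahead of it. It does not
  influence the cells behind it, so one can run time forward until it reaches the boundary, remove
  it there, and run time back.
\<close>

lemma reach_delete_front:
  assumes "even n" "4 \<le> n" "even k" "2 \<le> k" "k < n" "f \<in> confs n"
    and "\<And>x. x < k - 1 \<Longrightarrow> \<not> f x" "k = 2 \<or> f (k - 1)" "f k" "\<not> f (k + 1)"
  shows "reach n f (f(k - 1 := False, k := False))"
  using assms
proof (induction k arbitrary: f rule: less_induct)
  case (less k)
  show ?case
  proof (cases "k = 2")
    case True
    then have "k - 1 = 1" "\<not> f 3"
      using less.prems(10) by (simp_all add: numeral_3_eq_3)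
    then show ?thesis
      using reach_clear_first_two[OF less.prems(6,2)] True by (simp only: simp_thms)
  next
    case False
    define j where "j = k - 2"
    have j: "k = j + 2" "even j" "2 \<le> j"
      using less.prems(3,4) False unfolding j_def by presburger+
    have kn: "j + 3 < n"
      using less.prems(1,3,5) j by presburger
    let ?g = "f(k - 1 := False, k := False)"
    let ?F = "\<lambda>f. sweep (odd_sites n) (sweep (even_sites n) f)"
    have f: "\<And>x. x \<le> j \<Longrightarrow> \<not> f x" "f (j + 1)" "f (j + 2)" "\<not> f (Suc (Suc (Suc j)))"
      using less.prems(7-10) j False by (auto simp: numeral_3_eq_3)
    \<comment> \<open>One deterministic step carries the pair from \<open>(k - 1, k)\<close> to
      \<open>(j - 1, j)\<close>. Halfway it sits at \<open>(j, j + 1)\<close>, and elsewhere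
      \<open>f\<close> and \<open>?g\<close> evolve alike.\<close>
    have Ef: "sweep (even_sites n) f = (sweep (even_sites n) ?g)(j := True, j + 1 := True)"
    proof
      fix x :: nat
      consider "x < j" | "x = j" | "x = j + 1" | "x = j + 2" | "x = j + 3" | "j + 4 \<le> x"
        by linarith
      then show "sweep (even_sites n) f x
          = ((sweep (even_sites n) ?g)(j := True, j + 1 := True)) x"
        using f j kn by cases (auto simp: sweep_def even_sites_def)
    qed
    have Eg: "\<And>x. x \<le> j + 2 \<Longrightarrow> \<not> sweep (even_sites n) ?g x"
      using f j by (auto simp: sweep_def even_sites_def le_Suc_eq numeral_3_eq_3)
    \<comment> \<open>For \<open>j = 2\<close> the cell \<open>j - 1\<close> is the first one, which
      the sweep does not touch, so it stays empty; this is why the invariant leaves cell 1 free when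
      \<open>k = 2\<close>.\<close>
    have Ff: "?F f x = ((?F ?g)(j - 1 := 2 < j, j := True)) x" for x
    proof -
      consider "x < j - 1" | "x = j - 1" | "x = j" | "x = j + 1" | "x = j + 2" | "j + 3 \<le> x"
        by linarith
      then show ?thesis
        unfolding Ef using Eg j kn
        by cases (auto simp: odd_sweep_apply)
    qed
    have Fg: "\<not> ?F ?g x" if "x \<le> j + 1" for x
      using Eg that by (auto simp: odd_sweep_apply)
    have "reach n (?F f) ((?F f)(j - 1 := False, j := False))"
    proof (rule less.IH)
      show "?F f \<in> confs n"
        using less.prems by (intro odd_sweep_in_confs even_sweep_in_confs)
      show "\<not> ?F f x" if "x < j - 1" for x
        using that Ff[of x] Fg[of x] by simp
      show "j = 2 \<or> ?F f (j - 1)" "?F f j"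
        using Ff[of "j - 1"] Ff[of j] j(3) by auto
      show "\<not> ?F f (j + 1)"
        using Ff[of "j + 1"] Fg[of "j + 1"] j(3) by auto
    qed (use less.prems j kn in auto)
    \<comment> \<open>Deleting the pair commutes with the step, so the path goes from
      \<open>f\<close> to \<open>?F f\<close>, to \<open>?F ?g\<close>, and back in time to
      \<open>?g\<close>.\<close>
    moreover have "(?F f)(j - 1 := False, j := False) = ?F ?g"
      using Ff Fg by (auto simp: fun_eq_iff)
    moreover have gc: "?g \<in> confs n"
      using less.prems by (auto simp: confs_def)
    ultimately show ?thesis
      using reach_deterministic_step[of n f] reach_sym[OF reach_deterministic_step gc] less.prems
      by (metis reach_trans le_trans one_le_numeral)
  qed
qed

section \<open>Moving the leftmost occupied cell to the right\<close>

lemma reach_clear_odd: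
  assumes "even n" "4 \<le> n" "even j" "2 \<le> j" "j + 1 < n" "f \<in> confs n"
    and zero: "\<And>x. x \<le> j \<Longrightarrow> \<not> f x" and front: "f (j + 1)"
  defines "h \<equiv> sweep (odd_sites n) (sweep (even_sites n) f)"
  shows "reach n f (h(j - 1 := False, j := False))"
    and "\<And>x. x \<le> j + 1 \<Longrightarrow> \<not> (h(j - 1 := False, j := False)) x"
    and "h(j - 1 := False, j := False) \<in> confs n"
proof -
  let ?e = "sweep (even_sites n) f"
  \<comment> \<open>The even sweep fills cell \<open>j\<close>; the odd sweep then empties
    \<open>j + 1\<close> and, if \<open>2 < j\<close>, fills \<open>j - 1\<close>. The front has
    become a left-moving pair at \<open>(j - 1, j)\<close>, which \<open>reach_delete_front\<close>
    removes.\<close>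
  have e: "\<And>x. x < j \<Longrightarrow> \<not> ?e x" "?e j" "?e (j + 1)"
    using assms by (auto simp: sweep_def even_sites_def)
  have low: "\<not> h x" if "x < j - 1" for x
    using that e assms(3-5) by (auto simp: h_def odd_sweep_apply)
  have "j = 2 \<or> h (j - 1)"
    using e assms(3-5) by (auto simp: h_def odd_sweep_apply)
  moreover have "h j"
    using e assms(3-5) by (auto simp: h_def odd_sweep_apply)
  moreover have high: "\<not> h (j + 1)"
    using e assms(3-5) by (auto simp: h_def odd_sweep_apply)
  moreover have hc: "h \<in> confs n"
    unfolding h_def using assms(6) by (intro odd_sweep_in_confs even_sweep_in_confs)
  ultimately have "reach n h (h(j - 1 := False, j := False))"
    using assms(1-5) low by (intro reach_delete_front) auto
  then show "reach n f (h(j - 1 := False, j := False))"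
    unfolding h_def by (rule reach_trans[OF reach_deterministic_step])
  show "\<not> (h(j - 1 := False, j := False)) x" if "x \<le> j + 1" for x
  proof -
    have "x < j - 1 \<or> x = j - 1 \<or> x = j \<or> x = j + 1"
      using that by linarith
    then show ?thesis
      using low high by auto
  qed
  show "h(j - 1 := False, j := False) \<in> confs n"
    using hc by (auto simp: confs_def)
qed

text \<open>The cases follow the parity of the front \<open>l\<close> and its right neighbour: the
  front vanishes by itself, is cleared by the boundary moves, or turns into a left-moving pair that
  is deleted.\<close>

lemma reach_advance_front:
  assumes "even n" "4 \<le> n" and f: "f \<in> confs n" and l: "1 \<le> l" "l \<le> n"
    and zero: "\<And>x. x < l \<Longrightarrow> \<not> f x"
  obtains g where "g \<in> confs n" "reach n f g" "\<And>x. x \<le> l \<Longrightarrow> \<not> g x"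
proof -
  let ?F = "\<lambda>f. sweep (odd_sites n) (sweep (even_sites n) f)"
  have Fc: "?F f \<in> confs n"
    using f by (intro odd_sweep_in_confs even_sweep_in_confs)
  have "l = n \<or> l = 1 \<or> odd l \<and> 3 \<le> l \<and> l < n \<or> l = 2 \<or> even l \<and> 4 \<le> l \<and> l < n"
    using l by presburger
  then consider (empty) "\<not> f l" | (last) "l = n" "f l" | (first) "l = 1"
    | (odd) "odd l" "3 \<le> l" "l < n" "f l"
    | (right) "even l" "2 \<le> l" "l < n" "f l" "f (l + 1)"
    | (second) "l = 2" "f l" "\<not> f 3"
    | (left) "even l" "4 \<le> l" "l < n" "f l" "\<not> f (l + 1)"
    using assms(2) by (cases "f l"; cases "f (l + 1)") auto
  then show thesis
  proof cases
    case empty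
    then have "\<not> f x" if "x \<le> l" for x
      using zero[of x] that by (cases "x = l") auto
    then show thesis using that f reach_refl by blast
  next
    case last
    have "flip n True f = (\<lambda>_. False)"
      using last f zero by (auto simp: flip_def confs_def fun_eq_iff)
    then have "step n False True f = (\<lambda>_. False)"
      by (simp add: step_def sweep_def)
    then have "reach n f (\<lambda>_. False)"
      using reach_step[of n f False True] by simp
    then show thesis by (rule that[rotated]) (auto simp: confs_def)
  next
    case first
    have "reach n f (flip 1 (f 1) f)"
      using f assms(2) by (intro reach_flip_first) auto
    moreover have "flip 1 (f 1) f = f(1 := False)"
      by (auto simp: flip_def)
    ultimately show thesis
      using zero f first
      by (intro that[of "f(1 := False)"]) (auto simp: confs_def le_Suc_eq)
  next
    case second
    then show thesis
      using zero f assms(2) reach_clear_first_two[OF f assms(2)]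
      by (intro that[of "f(1 := False, 2 := False)"]) (auto simp: confs_def)
  next
    case right
    \<comment> \<open>The occupied right neighbour makes the even sweep empty cell \<open>l\<close>;
      nothing up to \<open>l\<close> is then left to fill a cell to its left.\<close>
    have e: "\<not> sweep (even_sites n) f x" if "x \<le> l" for x
    proof -
      consider "x = l" | "x + 1 = l" | "x + 1 < l"
        using \<open>x \<le> l\<close> by linarith
      then show ?thesis
        using right zero by cases (auto simp: even_sweep_apply)
    qed
    have "\<not> ?F f x" if "x \<le> l" for x
      using that e right(1) by (cases "x = l") (auto simp: odd_sweep_apply)
    then show thesis
      using that Fc reach_deterministic_step by blast
  next
    case odd
    define j where "j = l - 1"
    have j: "l = j + 1" "even j" "2 \<le> j"
      using odd unfolding j_def by auto
    show thesis
      using reach_clear_odd[of n j f] assms(1,2) f zero odd j that by auto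
  next
    case left
    \<comment> \<open>The first step keeps cell \<open>l\<close> occupied and fills
      \<open>l - 1 = j + 1\<close>, an odd front for \<open>reach_clear_odd\<close>;
      \<open>4 \<le> l\<close> ensures \<open>2 \<le> j\<close>.\<close>
    define j where "j = l - 2"
    have j: "l = j + 2" "even j" "2 \<le> j"
      using left unfolding j_def by auto
    have e: "\<not> sweep (even_sites n) f x" if "x < l" for x
    proof -
      consider "x + 1 = l" | "x + 1 < l"
        using \<open>x < l\<close> by linarith
      then show ?thesis
        using left zero by cases (auto simp: even_sweep_apply)
    qed
    have el: "sweep (even_sites n) f l" "\<not> sweep (even_sites n) f (l + 1)"
      using left zero by (auto simp: sweep_def even_sites_def)
    have F: "\<not> ?F f x" if "x \<le> j" for x
      using that e j by (auto simp: odd_sweep_apply)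
    have Fj: "?F f (j + 1)" "?F f (j + 2)"
      using e el j left(3) by (auto simp: odd_sweep_apply)
    let ?g = "(?F (?F f))(j - 1 := False, j := False)"
    \<comment> \<open>The clearing lemma covers only the cells up to \<open>j + 1\<close>; cell
      \<open>l = j + 2\<close> is emptied by the second even sweep, which sees cell
      \<open>j + 1\<close> occupied.\<close>
    have "\<not> ?F (?F f) (j + 2)"
      using Fj j left(3)
      by (auto simp: odd_sweep_apply[of n "sweep (even_sites n) (?F f)"]
          even_sweep_apply[of n "?F f"])
    note clear = reach_clear_odd[OF assms(1,2) j(2,3) _ Fc F Fj(1)]
    have jn: "j + 1 < n" using j left by simp
    show thesis
    proof (rule that)
      show "?g \<in> confs n" "reach n f ?g"
        using clear[OF jn] reach_deterministic_step reach_trans by blast+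
      show "\<not> ?g x" if "x \<le> l" for x
      proof (cases "x \<le> j + 1")
        case True
        then show ?thesis using clear(2)[OF jn] by blast
      next
        case False
        then have "x = j + 2" using that j by simp
        then show ?thesis using \<open>\<not> ?F (?F f) (j + 2)\<close> by simp
      qed
    qed
  qed
qed

text \<open>Each use of \<open>reach_advance_front\<close> lengthens the empty prefix; the induction
  is on the number \<open>Suc n - l\<close> of cells not known to be empty.\<close>

lemma reach_zero:
  assumes "even n" "4 \<le> n" "f \<in> confs n"
  shows "reach n f (\<lambda>_. False)"
proof -
  have "reach n f (\<lambda>_. False)" if "f \<in> confs n" "1 \<le> l" "\<And>x. x < l \<Longrightarrow> \<not> f x" for l f
    using that
  proof (induction "Suc n - l" arbitrary: l f rule: less_induct)
    case less
    show ?case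
    proof (cases "l \<le> n")
      case True
      obtain g where g: "g \<in> confs n" "reach n f g" "\<And>x. x \<le> l \<Longrightarrow> \<not> g x"
        using reach_advance_front[OF assms(1,2) less.prems(1,2) True less.prems(3)] by blast
      then have "reach n g (\<lambda>_. False)"
        using True by (intro less.hyps[of "Suc l"]) auto
      then show ?thesis using g(2) reach_trans by blast
    next
      case False
      then have "f = (\<lambda>_. False)"
        using less.prems by (auto simp: confs_def fun_eq_iff)
      then show ?thesis by (simp add: reach_refl)
    qed
  qed
  from this[of f 1] show ?thesis
    using assms(3) by (auto simp: confs_def)
qed

section \<open>From reachability to positive matrix powers\<close>

lemma reach_all:
  assumes "even n" "4 \<le> n" "f \<in> confs n" "g \<in> confs n"
  shows "reach n f g"
  using reach_zero[OF assms(1-3)] reach_sym[OF reach_zero[OF assms(1,2,4)] assms(4)] assms(2)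
  by (auto intro: reach_trans)

text \<open>The bits may vary along the path, yet all steps are realized by the same
  \<open>U\<close>. Peeling off the first step fits the power, whose new factor stands on the right
  and acts first.\<close>

lemma realizes_pow_if_reach:
  assumes U: "\<And>v w. realizes n U (step n v w)" and "reach n f g"
  shows "\<exists>t T. realizes n (U ^\<^sub>m t) T \<and> T f = g"
  using assms(2) unfolding reach_def
proof (induction rule: converse_rtranclp_induct)
  case base
  have "U \<in> carrier_mat (2 ^ n) (2 ^ n)"
    using U by (simp add: realizes_def)
  then have "realizes n (U ^\<^sub>m 0) id"
    using realizes_one by simp
  then show ?case by (metis id_apply)
next
  case (step f f')
  then obtain t T v w where T: "realizes n (U ^\<^sub>m t) T" "T f' = g" and f': "f' = step n v w f"
    by blast
  have "realizes n (U ^\<^sub>m Suc t) (T \<circ> step n v w)"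
    using realizes_mult[OF T(1) U] by simp
  then show ?case using T(2) f' by (metis comp_apply)
qed

theorem theorem1:
  fixes n :: nat and \<alpha> \<beta> \<gamma> \<delta> :: real
  assumes "even n" and "n \<ge> 4"
    and "0 < \<alpha>" "\<alpha> < 1" and "0 < \<beta>" "\<beta> < 1"
    and "0 < \<gamma>" "\<gamma> < 1" and "0 < \<delta>" "\<delta> < 1"
  shows "irreducible_mat (propagator n \<alpha> \<beta> \<gamma> \<delta>) \<and> aperiodic_mat (propagator n \<alpha> \<beta> \<gamma> \<delta>)"
proof -
  define U where "U = propagator n \<alpha> \<beta> \<gamma> \<delta>"
  have U: "realizes n U (step n v w)" for v w
    unfolding U_def using assms by (intro realizes_propagator)
  have carrier: "U \<in> carrier_mat (2 ^ n) (2 ^ n)"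
    using U by (simp add: realizes_def)
  have "0 \<le> x" if "x \<in> elements_mat U" for x
    using that U[of False False] carrier by (auto simp: realizes_def elements_mat_def)
  moreover have "\<exists>t>0. 0 < (U ^\<^sub>m t) $$ (j, i)" if ij: "i < 2 ^ n" "j < 2 ^ n" for i j
  proof -
    \<comment> \<open>One step is taken beforehand so that the exponent is positive even when
      \<open>i = j\<close>.\<close>
    have "step n False False (conf n i) \<in> confs n"
      using assms(2) by (intro step_in_confs conf_in_confs) simp
    then have "reach n (step n False False (conf n i)) (conf n j)"
      by (intro reach_all assms(1,2) conf_in_confs)
    then obtain t T where T: "realizes n (U ^\<^sub>m t) T"
      "T (step n False False (conf n i)) = conf n j"
      using realizes_pow_if_reach[OF U] by blast
    have "realizes n (U ^\<^sub>m Suc t) (T \<circ> step n False False)"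
      using realizes_mult[OF T(1) U] by simp
    then have "0 < (U ^\<^sub>m Suc t) $$ (j, i)"
      using ij T(2) unfolding realizes_def by (metis comp_apply)
    then show ?thesis by blast
  qed
  ultimately have "irreducible_mat U"
    using carrier unfolding irreducible_mat_def by auto
  moreover have "aperiodic_mat U"
    unfolding aperiodic_mat_def
  proof (intro exI conjI)
    \<comment> \<open>Index 0 is the empty configuration, a fixed point of the step without flips;
      hence 1 is a return time.\<close>
    have zero: "conf n 0 = (\<lambda>_. False)"
      by (simp add: conf_def)
    have "step n False False (\<lambda>_. False) = (\<lambda>_. False)"
      by (simp add: step_def sweep_def)
    then have "0 < U $$ (0, 0)"
      using U[of False False] zero by (simp add: realizes_def)
    then have "0 < (U ^\<^sub>m 1) $$ (0, 0)"
      using carrier by simp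
    then have "Gcd {t. 0 < t \<and> 0 < (U ^\<^sub>m t) $$ (0, 0)} dvd 1"
      by (intro Gcd_dvd) simp
    then show "Gcd {t. 0 < t \<and> 0 < (U ^\<^sub>m t) $$ (0, 0)} = 1" by simp
    show "0 < dim_row U" using carrier by simp
  qed
  ultimately show ?thesis unfolding U_def by simp
qed

end
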